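(* In the Gaussian regression model $y_k=S(x_k)+g(x_k,S)\xi_k$, $k=1,\dots,n$, $x_k=k/n$, with $\xi_1,\dots,\xi_n$ i.i.d. $\mathcal N(0,1)$, under the standing assumptions (A1)–(A3) on $g$ listed in the context, the kernel estimator $$\hat S_n(z_0)=\frac1{q_n}\sum_{k=1}^nQ\Big(\frac{x_k-z_0}{h}\Big)y_k$$ satisfies $$\limsup_{\delta\to0}\ \limsup_{n\to\infty}\ \mathcal R_{z_0,\delta}(\hat S_n(z_0))\ \le\ \frac{\mathbb E|\xi|}{\sqrt2},\qquad \xi\sim\mathcal N(0,1).$$
   Context: Setting. Fix $z_0\in(0,1)$ and $\beta=1+\alpha$ with $\alpha\in(0,1]$. $C^1([0,1],\mathbb R)$ is the space of continuously differentiable functions on $[0,1]$, and $\|f\|=\sup_{x\in[0,1]}|f(x)|$. The function $g:[0,1]\times C^1([0,1],\mathbb R)\to(0,\infty)$ is a scale functional, and $S$ is the unknown regression function. Classes. For $M,K>0$, $$\mathcal H(M,K,\beta)=\Big\{S\in C^1([0,1],\mathbb R):\ \|S'\|\le M,\ \sup_{x,y\in[0,1],\,x\ne y}\frac{|S'(y)-S'(x)|}{|x-y|^{\alpha}}\le K\Big\},\qquad \mathcal H(\beta)=\bigcup_{M>0,K>0}\mathcal H(M,K,\beta).$$ For $0<\delta<1$, $$\mathcal U_{z_0,\delta}=\Big\{S\in\mathcal H(\beta):\ \|S'\|\le\delta^{-1},\ \Big|\int_{-1}^1\big(S(z_0+tu)-S(z_0)\big)du\Big|\le\delta t^{\beta}\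 \text{ for all } t>0 \text{ with } [z_0-t,z_0+t]\subset[0,1]\Big\}.$$ Notation. $\varphi_n=n^{\beta/(2\beta+1)}$, $h=n^{-1/(2\beta+1)}$, $Q=\mathbb I_{[-1,1]}$ (indicator function), $x_k=k/n$, $q_n=\sum_{k=1}^nQ\big(\frac{x_k-z_0}{h}\big)$. Standing assumptions on $g$. (A1) For every $\delta\in(0,1)$, $$\lim_{n\to\infty}\ \sup_{S\in\mathcal U_{z_0,\delta}}\left|\Big(\frac1{q_n}\sum_{k=1}^nQ\Big(\frac{x_k-z_0}{h}\Big)g^2(x_k,S)\Big)^{1/2}-g(z_0,S)\right|=0.$$ (A2) There are $g_\star>0$ and $g^\star<\infty$ with $g_\star\le g(x,S)\le g^\star$ for all $x\in[0,1]$ and $S\in C^1([0,1],\mathbb R)$. (A3) For all $S,S_0\in C^1([0,1],\mathbb R)$ and $x\in[0,1]$, $g(x,S)=g(x,S_0)+L_{x,S_0}(S-S_0)+\Gamma_{x,S_0}(S-S_0)$, where $L_{x,S_0}$ is a linear functional on $C^1([0,1],\mathbb R)$ for which there is a constant $C_{S_0}>0$ with $\sup_{x\in[0,1]}\sup_{S\in C^1([0,1],\mathbb R),\,\|S\|\ne0}|L_{x,S_0}(S)|/\|S\|\le C_{S_0}$, and $\lim_{\|S\|\to0}\sup_{x\in[0,1]}|\Gamma_{x,S_0}(S)|/\|S\|=0$. Risk. For an estimator $\tilde S$ of $S(z_0)$ (a measurable real-valued function of $(y_1,\dots,y_n)$), $$\mathcal R_{z_0,\delta}(\tilde S)=\sup_{S\in\mathcal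 U_{z_0,\delta}}\mathbb E_S\Big[\varphi_n\frac{|\tilde S-S(z_0)|}{g(z_0,S)}\Big],$$ where $\mathbb E_S$ is the expectation under the law of $(y_1,\dots,y_n)$ when the regression function is $S$. *)

theory Defs
  imports "HOL-Probability.Probability"
begin

definition deriv01 :: "(real \<Rightarrow> real) \<Rightarrow> real \<Rightarrow> real" where
  "deriv01 S x = vector_derivative S (at x within {0..1})"

text \<open>
  A function on \<open>[0,1]\<close> is represented by its extension by zero to the whole real line. This makes
  the representation unique, so that a functional on \<open>C1\<close> sees only the values on \<open>[0,1]\<close>, and it
  is preserved by pointwise linear combinations. At the end points the derivative is one-sided.
\<close>

definition C1 :: "(real \<Rightarrow> real) set" where
  "C1 = {S. S differentiable_on {0..1} \<and> continuous_on {0..1} (deriv01 S) \<and>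
            (\<forall>x. x \<notin> {0..1} \<longrightarrow> S x = 0)}"

text \<open>The real supremum below is meaningful for bounded functions; it is only applied to elements
  of \<open>C1\<close> and to their derivatives, which are continuous on \<open>[0,1]\<close>.\<close>

definition sup_norm :: "(real \<Rightarrow> real) \<Rightarrow> real" where
  "sup_norm f = (SUP x\<in>{0..1}. \<bar>f x\<bar>)"

definition holder_ball :: "real \<Rightarrow> real \<Rightarrow> real \<Rightarrow> (real \<Rightarrow> real) set" where
  "holder_ball M K \<beta> = {S \<in> C1. sup_norm (deriv01 S) \<le> M \<and>
     (\<forall>x\<in>{0..1}. \<forall>y\<in>{0..1}. x \<noteq> y \<longrightarrow>
        \<bar>deriv01 S y - deriv01 S x\<bar> / \<bar>x - y\<bar> powr (\<beta> - 1) \<le> K)}"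

definition holder_class :: "real \<Rightarrow> (real \<Rightarrow> real) set" where
  "holder_class \<beta> = (\<Union>M\<in>{0<..}. \<Union>K\<in>{0<..}. holder_ball M K \<beta>)"

definition U_class :: "real \<Rightarrow> real \<Rightarrow> real \<Rightarrow> (real \<Rightarrow> real) set" where
  "U_class z\<^sub>0 \<beta> \<delta> = {S \<in> holder_class \<beta>. sup_norm (deriv01 S) \<le> inverse \<delta> \<and>
     (\<forall>t>0. {z\<^sub>0 - t..z\<^sub>0 + t} \<subseteq> {0..1} \<longrightarrow>
        \<bar>integral {-1..1} (\<lambda>u. S (z\<^sub>0 + t * u) - S z\<^sub>0)\<bar> \<le> \<delta> * t powr \<beta>)}"

definition rate :: "real \<Rightarrow> nat \<Rightarrow> real" where
  "rate \<beta> n = real n powr (\<beta> / (2 * \<beta> + 1))"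

definition bandwidth :: "real \<Rightarrow> nat \<Rightarrow> real" where
  "bandwidth \<beta> n = real n powr (- 1 / (2 * \<beta> + 1))"

definition design :: "nat \<Rightarrow> nat \<Rightarrow> real" where
  "design n k = real k / real n"

definition kernel_weight :: "real \<Rightarrow> real \<Rightarrow> nat \<Rightarrow> nat \<Rightarrow> real" where
  "kernel_weight z\<^sub>0 \<beta> n k = indicat_real {-1..1} ((design n k - z\<^sub>0) / bandwidth \<beta> n)"

definition kernel_mass :: "real \<Rightarrow> real \<Rightarrow> nat \<Rightarrow> real" where
  "kernel_mass z\<^sub>0 \<beta> n = (\<Sum>k=1..n. kernel_weight z\<^sub>0 \<beta> n k)"

text \<open>
  Conditions on the scale functional \<open>g x S\<close>; only its values for \<open>x \<in> {0..1}\<close> and \<open>S \<in> C1\<close> matter.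
  The supremum in the first condition is taken in the extended nonnegative reals.
\<close>

definition cond_A1 :: "real \<Rightarrow> real \<Rightarrow> (real \<Rightarrow> (real \<Rightarrow> real) \<Rightarrow> real) \<Rightarrow> bool" where
  "cond_A1 z\<^sub>0 \<beta> g \<longleftrightarrow> (\<forall>\<delta>\<in>{0<..<1}.
     (\<lambda>n. SUP S\<in>U_class z\<^sub>0 \<beta> \<delta>. ennreal
        \<bar>sqrt (1 / kernel_mass z\<^sub>0 \<beta> n *
              (\<Sum>k=1..n. kernel_weight z\<^sub>0 \<beta> n k * (g (design n k) S)\<^sup>2)) - g z\<^sub>0 S\<bar>)
     \<longlonglongrightarrow> 0)"

definition cond_A2 :: "(real \<Rightarrow> (real \<Rightarrow> real) \<Rightarrow> real) \<Rightarrow> bool" where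
  "cond_A2 g \<longleftrightarrow> (\<exists>g_low>0. \<exists>g_high. \<forall>x\<in>{0..1}. \<forall>S\<in>C1. g_low \<le> g x S \<and> g x S \<le> g_high)"

definition linear_on_C1 :: "((real \<Rightarrow> real) \<Rightarrow> real) \<Rightarrow> bool" where
  "linear_on_C1 L \<longleftrightarrow>
     (\<forall>S\<in>C1. \<forall>T\<in>C1. L (\<lambda>x. S x + T x) = L S + L T) \<and>
     (\<forall>c. \<forall>S\<in>C1. L (\<lambda>x. c * S x) = c * L S)"

definition cond_A3 :: "(real \<Rightarrow> (real \<Rightarrow> real) \<Rightarrow> real) \<Rightarrow> bool" where
  "cond_A3 g \<longleftrightarrow> (\<exists>L \<Gamma>. \<forall>S\<^sub>0\<in>C1.
     (\<forall>x\<in>{0..1}. \<forall>S\<in>C1.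
        g x S = g x S\<^sub>0 + L x S\<^sub>0 (\<lambda>u. S u - S\<^sub>0 u) + \<Gamma> x S\<^sub>0 (\<lambda>u. S u - S\<^sub>0 u)) \<and>
     (\<forall>x\<in>{0..1}. linear_on_C1 (L x S\<^sub>0)) \<and>
     (\<exists>C>0. \<forall>x\<in>{0..1}. \<forall>S\<in>C1. sup_norm S \<noteq> 0 \<longrightarrow> \<bar>L x S\<^sub>0 S\<bar> / sup_norm S \<le> C) \<and>
     (\<forall>\<epsilon>>0. \<exists>\<eta>>0. \<forall>S\<in>C1. 0 < sup_norm S \<and> sup_norm S < \<eta> \<longrightarrow>
        (\<forall>x\<in>{0..1}. \<bar>\<Gamma> x S\<^sub>0 S\<bar> / sup_norm S \<le> \<epsilon>)))"

abbreviation std_normal :: "real measure" where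
  "std_normal \<equiv> density lborel std_normal_density"

definition observation ::
    "(real \<Rightarrow> (real \<Rightarrow> real) \<Rightarrow> real) \<Rightarrow> nat \<Rightarrow> (real \<Rightarrow> real) \<Rightarrow> (nat \<Rightarrow> real) \<Rightarrow> nat \<Rightarrow> real" where
  "observation g n S \<xi> = (\<lambda>k\<in>{1..n}. S (design n k) + g (design n k) S * \<xi> k)"

text \<open>The law of \<open>(y\<^sub>1, \<dots>, y\<^sub>n)\<close> when the regression function is \<open>S\<close>: the image of the law of
  \<open>n\<close> independent standard normal variables.\<close>

definition obs_law ::
    "(real \<Rightarrow> (real \<Rightarrow> real) \<Rightarrow> real) \<Rightarrow> nat \<Rightarrow> (real \<Rightarrow> real) \<Rightarrow> (nat \<Rightarrow> real) measure" where
  "obs_law g n S =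
     distr (\<Pi>\<^sub>M k\<in>{1..n}. std_normal) (\<Pi>\<^sub>M k\<in>{1..n}. borel) (observation g n S)"

definition risk ::
    "real \<Rightarrow> real \<Rightarrow> (real \<Rightarrow> (real \<Rightarrow> real) \<Rightarrow> real) \<Rightarrow> real \<Rightarrow> nat \<Rightarrow> ((nat \<Rightarrow> real) \<Rightarrow> real) \<Rightarrow> ennreal"
  where
  "risk z\<^sub>0 \<beta> g \<delta> n est =
     (SUP S\<in>U_class z\<^sub>0 \<beta> \<delta>.
        \<integral>\<^sup>+ y. ennreal (rate \<beta> n * (\<bar>est y - S z\<^sub>0\<bar> / g z\<^sub>0 S)) \<partial>obs_law g n S)"

definition kernel_estimator :: "real \<Rightarrow> real \<Rightarrow> nat \<Rightarrow> (nat \<Rightarrow> real) \<Rightarrow> real" where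
  "kernel_estimator z\<^sub>0 \<beta> n y =
     1 / kernel_mass z\<^sub>0 \<beta> n * (\<Sum>k=1..n. kernel_weight z\<^sub>0 \<beta> n k * y k)"

end

theory Submission imports Defs begin

text \<open>
  The error of the estimator splits into a bias and a centred Gaussian noise. For \<open>S\<close> in the class,
  which is \<open>inverse \<delta>\<close>-Lipschitz, the sum over the window \<open>[z - h, z + h]\<close> differs from
  \<open>n\<close> times the integral by at most \<open>5 * h / \<delta>\<close>; as \<open>rate * h powr \<beta> = 1\<close> and
  \<open>q / (n * h) \<longlonglongrightarrow> 2\<close>, the normalised bias is at most \<open>\<delta> / 2 + o(1)\<close> uniformly in \<open>S\<close>.
  The noise has standard deviation \<open>G / sqrt q\<close>, where \<open>G\<close> is the quadratic mean of \<open>g\<close> over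
  the window, so by (A1) and \<open>rate = sqrt (n * h)\<close> its normalised first absolute moment tends
  uniformly to that of a standard normal variable divided by \<open>sqrt 2\<close>.
\<close>

section \<open>Lipschitz functions and their Riemann sums\<close>

text \<open>The constant is the same for every \<open>S\<close> in the class, although
  \<open>holder_class\<close> is a union over arbitrarily large bounds. This makes the
  discretization error below uniform in \<open>S\<close>.\<close>

lemma U_class_lipschitz:
  assumes "S \<in> U_class z \<beta> \<delta>" "0 < \<delta>"
  shows "(inverse \<delta>)-lipschitz_on {0..1} S"
proof (rule bounded_derivative_imp_lipschitz)
  have diff: "S differentiable_on {0..1}" and cont: "continuous_on {0..1} (deriv01 S)"
    and norm: "sup_norm (deriv01 S) \<le> inverse \<delta>"
    using assms by (auto simp: U_class_def holder_class_def holder_ball_def C1_def)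
  fix x :: real assume x: "x \<in> {0..1}"
  then show "(S has_derivative (\<lambda>h. h *\<^sub>R deriv01 S x)) (at x within {0..1})"
    using diff unfolding has_vector_derivative_def[symmetric] deriv01_def
    by (auto simp: differentiable_on_def vector_derivative_works)
  \<comment> \<open>A real supremum dominates its members only if the set is bounded above;
    continuity of the derivative on the compact interval ensures this.\<close>
  have "bdd_above ((\<lambda>x. \<bar>deriv01 S x\<bar>) ` {0..1})"
    using cont by (intro compact_imp_bounded[THEN bounded_imp_bdd_above] compact_continuous_image
        continuous_intros) auto
  then have "\<bar>deriv01 S x\<bar> \<le> inverse \<delta>"
    using norm x unfolding sup_norm_def by (meson cSUP_upper order_trans)
  then show "onorm (\<lambda>h. h *\<^sub>R deriv01 S x) \<le> inverse \<delta>"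
    by (intro onorm_le) (auto simp: abs_mult mult.commute[of "inverse \<delta>"] intro: mult_left_mono)
qed (use assms in auto)

text \<open>The reference point \<open>c\<close> may lie outside \<open>{a..b}\<close>. It is the
  right end of a grid cell in \<open>riemann_sum_error\<close>, but the centre of the window in
  \<open>sum_grid_window_error\<close>, where the interval is a short piece at the window's
  edge.\<close>

lemma lipschitz_integral_bound:
  fixes f :: "real \<Rightarrow> real"
  assumes lip: "L-lipschitz_on X f" and "{a..b} \<subseteq> X" "a \<le> b" "c \<in> X"
    and r: "\<And>x. x \<in> {a..b} \<Longrightarrow> \<bar>x - c\<bar> \<le> r"
  shows "\<bar>integral {a..b} f - (b - a) * f c\<bar> \<le> L * r * (b - a)"
proof -
  have cont: "continuous_on {a..b} f"
    using lip assms(2) continuous_on_subset lipschitz_on_continuous_on by blast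
  have "norm (integral {a..b} (\<lambda>x. f x - f c)) \<le> L * r * (b - a)"
  proof (rule integral_bound[OF \<open>a \<le> b\<close>])
    show "continuous_on {a..b} (\<lambda>x. f x - f c)"
      by (intro continuous_intros cont)
    fix x assume x: "x \<in> {a..b}"
    have "dist (f x) (f c) \<le> L * dist x c"
      using assms x by (intro lipschitz_onD[OF lip]) auto
    also have "\<dots> \<le> L * r"
      using r[OF x] lipschitz_on_nonneg[OF lip] by (intro mult_left_mono) (auto simp: dist_real_def)
    finally show "norm (f x - f c) \<le> L * r" by (simp add: dist_norm)
  qed
  moreover have "integral {a..b} (\<lambda>x. f x - f c) = integral {a..b} f - (b - a) * f c"
    using \<open>a \<le> b\<close> by (subst integral_diff) (auto intro: integrable_continuous_interval cont)
  ultimately show ?thesis by simp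
qed

text \<open>Induction on \<open>b\<close> adds one cell at a time. Each cell is matched with its
  right end, so the sum starts after \<open>a\<close>, and each contributes an error of at most
  \<open>L / real n\<close>.\<close>

lemma riemann_sum_error:
  fixes f :: "real \<Rightarrow> real"
  assumes lip: "L-lipschitz_on {u..v} f" and n: "n > 0"
    and "a \<le> b" "u \<le> real a / real n" "real b / real n \<le> v"
  shows "\<bar>(\<Sum>k\<in>{a<..b}. f (real k / real n)) - real n * integral {real a / real n..real b / real n} f\<bar>
         \<le> (real b - real a) * L / real n"
  using \<open>a \<le> b\<close> \<open>real b / real n \<le> v\<close>
proof (induction b rule: dec_induct)
  case base
  then show ?case by simp
next
  case (step b)
  let ?x = "\<lambda>k. real k / real n"
  have le: "u \<le> ?x a" "?x a \<le> ?x b" "?x b \<le> ?x (Suc b)" "?x (Suc b) \<le> v"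
    using step assms(4) n by (auto simp: divide_right_mono)
  have wd: "?x (Suc b) - ?x b = 1 / real n"
    using n by (simp add: field_simps)
  have int: "f integrable_on {?x a..?x (Suc b)}"
    using le by (intro integrable_continuous_interval lipschitz_on_continuous_on[OF lipschitz_on_subset[OF lip]]) auto
  have split: "integral {?x a..?x (Suc b)} f = integral {?x a..?x b} f + integral {?x b..?x (Suc b)} f"
    using le int by (intro Henstock_Kurzweil_Integration.integral_combine[symmetric]) auto
  \<comment> \<open>On a cell of width \<open>1 / real n\<close> the function differs from its value
    at the right end by at most \<open>L / real n\<close>. The width gives a second factor
    \<open>1 / real n\<close>, which the multiplication by \<open>real n\<close> cancels.\<close>
  have "\<bar>integral {?x b..?x (Suc b)} f - (?x (Suc b) - ?x b) * f (?x (Suc b))\<bar>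
      \<le> L * (1 / real n) * (?x (Suc b) - ?x b)"
    by (rule lipschitz_integral_bound[OF lip]) (use le wd in auto)
  then have "real n * \<bar>integral {?x b..?x (Suc b)} f - 1 / real n * f (?x (Suc b))\<bar>
      \<le> real n * (L * (1 / real n) * (1 / real n))"
    unfolding wd by (rule mult_left_mono) simp
  moreover have "real n * integral {?x b..?x (Suc b)} f - f (?x (Suc b))
     = real n * (integral {?x b..?x (Suc b)} f - 1 / real n * f (?x (Suc b)))"
    using n by (simp add: right_diff_distrib)
  ultimately have cell: "\<bar>real n * integral {?x b..?x (Suc b)} f - f (?x (Suc b))\<bar> \<le> L / real n"
    using n by (simp add: abs_mult)
  have "?x b \<le> v" using le by linarith
  note IH = step.IH[OF this]
  have "{a<..Suc b} = insert (Suc b) {a<..b}" using step by auto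
  then have sum: "(\<Sum>k\<in>{a<..Suc b}. f (?x k)) = (\<Sum>k\<in>{a<..b}. f (?x k)) + f (?x (Suc b))"
    by simp
  have "(real (Suc b) - real a) * L / real n = (real b - real a) * L / real n + L / real n"
    by (simp add: add_divide_distrib[symmetric] algebra_simps)
  then show ?case
    unfolding sum split distrib_left using cell IH by linarith
qed

section \<open>Grid points in a window around z\<close>

text \<open>The indices are obtained by rounding \<open>n * (z - h)\<close> up and
  \<open>n * (z + h)\<close> down. Both numbers are positive, so the conversion to
  \<open>nat\<close> truncates nothing.\<close>

lemma grid_window:
  fixes z h :: real
  assumes "n > 0" "1 \<le> real n * h" "0 < z - h"
  obtains a b where "a \<le> b" "{k. \<bar>real k / real n - z\<bar> \<le> h} = {a..b}"
    "z - h \<le> real a / real n" "real a / real n \<le> z - h + 1 / real n"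
    "real b / real n \<le> z + h" "z + h - 1 / real n \<le> real b / real n"
proof
  let ?a = "nat \<lceil>real n * (z - h)\<rceil>" and ?b = "nat \<lfloor>real n * (z + h)\<rfloor>"
  have pos: "real n * (z - h) > 0" using assms by simp
  have h: "h > 0" using assms by (smt (verit) mult_nonneg_nonpos of_nat_0_le_iff)
  have pos': "real n * (z + h) > 0" using assms h by simp
  have a: "real n * (z - h) \<le> real ?a" "real ?a \<le> real n * (z - h) + 1" using pos by linarith+
  have b: "real ?b \<le> real n * (z + h)" "real n * (z + h) - 1 \<le> real ?b" using pos' by linarith+
  have shift: "real n * (z - h + 1 / real n) = real n * (z - h) + 1"
    "real n * (z + h - 1 / real n) = real n * (z + h) - 1"
    using assms(1) by (simp_all add: distrib_left right_diff_distrib)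
  \<comment> \<open>Rounding loses at most 1 at each end, so \<open>?b - ?a\<close> is at least
    \<open>2 * n * h - 2\<close>, which is nonnegative because \<open>n * h\<close> is at least
    1.\<close>
  have "real ?a \<le> real ?b" using a b assms(2) unfolding ring_distribs by linarith
  then show "?a \<le> ?b" by simp
  show "{k. \<bar>real k / real n - z\<bar> \<le> h} = {?a..?b}"
  proof (intro set_eqI)
    fix k
    have "\<bar>real k / real n - z\<bar> \<le> h \<longleftrightarrow> real n * (z - h) \<le> real k \<and> real k \<le> real n * (z + h)"
      using assms(1) by (auto simp: abs_le_iff field_simps)
    also have "\<dots> \<longleftrightarrow> ?a \<le> k \<and> k \<le> ?b"
      using pos pos' by (auto simp: ceiling_le_iff le_floor_iff nat_le_iff le_nat_iff)
    finally show "k \<in> {k. \<bar>real k / real n - z\<bar> \<le> h} \<longleftrightarrow> k \<in> {?a..?b}" by simp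
  qed
  show "z - h \<le> real ?a / real n" "real ?a / real n \<le> z - h + 1 / real n"
    "real ?b / real n \<le> z + h" "z + h - 1 / real n \<le> real ?b / real n"
    using a b assms(1) shift by (simp_all add: pos_le_divide_eq pos_divide_le_eq mult.commute)
qed

text \<open>The count is \<open>b - a + 1\<close>, and \<open>b - a\<close> lies between
  \<open>2 * n * h - 2\<close> and \<open>2 * n * h\<close>.\<close>

lemma card_grid_window:
  assumes "n > 0" "1 \<le> real n * h" "0 < z - h"
  shows "\<bar>real (card {k. \<bar>real k / real n - z\<bar> \<le> h}) - 2 * (real n * h)\<bar> \<le> 1"
proof -
  obtain a b where ab: "a \<le> b" "{k. \<bar>real k / real n - z\<bar> \<le> h} = {a..b}"
    "z - h \<le> real a / real n" "real a / real n \<le> z - h + 1 / real n"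
    "real b / real n \<le> z + h" "z + h - 1 / real n \<le> real b / real n"
    using grid_window[OF assms] by metis
  have "z * real n - h * real n \<le> real a" "real a \<le> z * real n - h * real n + 1"
    "real b \<le> z * real n + h * real n" "z * real n + h * real n - 1 \<le> real b"
    using ab(3-6) assms(1)
    by (simp_all add: pos_le_divide_eq pos_divide_le_eq left_diff_distrib distrib_right)
  then show ?thesis
    unfolding ab(2) using ab(1) by (simp add: of_nat_diff abs_le_iff mult.commute)
qed

text \<open>As \<open>f z = 0\<close>, the function is at most \<open>L * h\<close> in absolute
  value on the window. The factor 5 collects 2 from the full cells, whose total length is at most
  \<open>2 * h\<close>, 1 from each of the two incomplete cells at the edges, and 1 from the grid
  point \<open>a\<close>, which the right-end sum omits.\<close>

lemma sum_grid_window_error: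
  fixes f :: "real \<Rightarrow> real"
  assumes lip: "L-lipschitz_on {z - h..z + h} f" and "f z = 0"
    and "n > 0" "1 \<le> real n * h" "0 < z - h"
  shows "\<bar>(\<Sum>k | \<bar>real k / real n - z\<bar> \<le> h. f (real k / real n)) - real n * integral {z - h..z + h} f\<bar>
         \<le> 5 * L * h"
proof -
  obtain a b where ab: "a \<le> b" "{k. \<bar>real k / real n - z\<bar> \<le> h} = {a..b}"
    "z - h \<le> real a / real n" "real a / real n \<le> z - h + 1 / real n"
    "real b / real n \<le> z + h" "z + h - 1 / real n \<le> real b / real n"
    using grid_window[OF assms(3-5)] by metis
  let ?x = "\<lambda>k. real k / real n"
  have n: "1 / real n > 0" using assms by simp
  have L: "L \<ge> 0" using lip by (rule lipschitz_on_nonneg)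
  have h: "h > 0" using assms by (smt (verit) mult_nonneg_nonpos of_nat_0_le_iff)
  have le: "?x a \<le> ?x b" using ab(1) by (simp add: divide_right_mono)
  have int: "f integrable_on {z - h..z + h}"
    by (intro integrable_continuous_interval lipschitz_on_continuous_on[OF lip])
  have "integral {z - h..z + h} f = integral {z - h..?x a} f + integral {?x a..z + h} f"
    using ab le int by (intro Henstock_Kurzweil_Integration.integral_combine[symmetric]) auto
  also have "integral {?x a..z + h} f = integral {?x a..?x b} f + integral {?x b..z + h} f"
    using ab le by (intro Henstock_Kurzweil_Integration.integral_combine[symmetric]
        integrable_on_subinterval[OF int]) auto
  finally have split: "integral {z - h..z + h} f =
    integral {z - h..?x a} f + (integral {?x a..?x b} f + integral {?x b..z + h} f)" .
  have bdry: "\<bar>real n * integral {s..t} f\<bar> \<le> L * h"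
    if "z - h \<le> s" "s \<le> t" "t \<le> z + h" "t - s \<le> 1 / real n" for s t
  proof -
    have "\<bar>integral {s..t} f - (t - s) * f z\<bar> \<le> L * h * (t - s)"
      by (rule lipschitz_integral_bound[OF lip]) (use that h in \<open>auto simp: abs_le_iff\<close>)
    also have "\<dots> \<le> L * h * (1 / real n)"
      using that L h by (intro mult_left_mono) auto
    finally have "real n * \<bar>integral {s..t} f\<bar> \<le> real n * (L * h * (1 / real n))"
      using \<open>f z = 0\<close> by (intro mult_left_mono) auto
    then show ?thesis using \<open>n > 0\<close> by (simp add: abs_mult)
  qed
  have left: "\<bar>real n * integral {z - h..?x a} f\<bar> \<le> L * h" by (rule bdry) (use ab le in auto)
  have right: "\<bar>real n * integral {?x b..z + h} f\<bar> \<le> L * h" by (rule bdry) (use ab le in auto)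
  have "?x a \<in> {z - h..z + h}" using ab le by auto
  then have "dist (f (?x a)) (f z) \<le> L * dist (?x a) z"
    using h by (intro lipschitz_onD[OF lip]) auto
  also have "\<dots> \<le> L * h"
    using L ab le by (intro mult_left_mono) (auto simp: dist_real_def abs_le_iff)
  finally have first: "\<bar>f (?x a)\<bar> \<le> L * h" using \<open>f z = 0\<close> by simp
  have "(real b - real a) * L / real n = L * (?x b - ?x a)"
    by (simp add: field_simps diff_divide_distrib)
  also have "\<dots> \<le> L * (2 * h)" using ab L by (intro mult_left_mono) auto
  finally have mid: "\<bar>(\<Sum>k\<in>{a<..b}. f (?x k)) - real n * integral {?x a..?x b} f\<bar> \<le> L * (2 * h)"
    using riemann_sum_error[OF lip \<open>n > 0\<close> ab(1,3,5)] by linarith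
  have "{a..b} = insert a {a<..b}" using ab(1) by auto
  then have "(\<Sum>k\<in>{a..b}. f (?x k)) = f (?x a) + (\<Sum>k\<in>{a<..b}. f (?x k))" by simp
  then show ?thesis
    unfolding ab(2) split distrib_left using first left right mid by linarith
qed

section \<open>Absolute moments of Gaussian sums\<close>

lemma prob_space_std_normal: "prob_space std_normal"
  by (rule prob_space_normal_density) simp

text \<open>Independence means that the joint law is the product of the marginals. The joint law of
  the coordinates is the product measure itself, because restriction to \<open>I\<close> is the
  identity on its space.\<close>

lemma indep_vars_PiM_coordinates:
  assumes "\<And>i. i \<in> I \<Longrightarrow> prob_space (M i)" and "I \<noteq> {}"
  shows "prob_space.indep_vars (PiM I M) M (\<lambda>i \<omega>. \<omega> i) I"
proof -
  interpret prob_space "PiM I M" by (rule prob_space_PiM) (rule assms)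
  have "distr (PiM I M) (PiM I M) (\<lambda>\<omega>. \<lambda>i\<in>I. \<omega> i) = distr (PiM I M) (PiM I M) (\<lambda>\<omega>. \<omega>)"
    by (intro distr_cong) (auto simp: space_PiM PiE_def extensional_restrict)
  also have "\<dots> = (\<Pi>\<^sub>M i\<in>I. distr (PiM I M) (M i) (\<lambda>\<omega>. \<omega> i))"
    using assms by (auto simp: distr_PiM_component intro!: PiM_cong)
  finally show ?thesis
    using assms(2) by (subst indep_vars_iff_distr_eq_PiM') auto
qed

lemma nn_integral_abs_std_normal:
  "(\<integral>\<^sup>+x. ennreal \<bar>x\<bar> \<partial>std_normal) = ennreal (\<integral>x. \<bar>x\<bar> \<partial>std_normal)"
proof (rule nn_integral_eq_integral)
  show "integrable std_normal abs"
    using integrable_std_normal_moment_abs[of 1]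
    by (subst integrable_density) auto
qed simp

text \<open>The sum is a centred normal variable whose variance is the sum of the squared
  coefficients; dividing by its standard deviation reduces the claim to a standard normal
  variable.\<close>

lemma nn_integral_abs_normal_sum:
  fixes c :: "'i \<Rightarrow> real"
  assumes "finite I"
  shows "(\<integral>\<^sup>+\<xi>. ennreal \<bar>\<Sum>i\<in>I. c i * \<xi> i\<bar> \<partial>(\<Pi>\<^sub>M i\<in>I. std_normal))
       = ennreal (sqrt (\<Sum>i\<in>I. (c i)\<^sup>2) * (\<integral>x. \<bar>x\<bar> \<partial>std_normal))"
proof -
  \<comment> \<open>\<open>sum_indep_normal\<close> requires positive standard deviations and a
    nonempty index set, so vanishing coefficients are dropped first. If none remain, both sides are
    0.\<close>
  define A where "A = {i\<in>I. c i \<noteq> 0}"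
  define \<sigma> where "\<sigma> = sqrt (\<Sum>i\<in>I. (c i)\<^sup>2)"
  let ?P = "\<Pi>\<^sub>M i\<in>I. std_normal"
  interpret prob_space ?P by (intro prob_space_PiM prob_space_std_normal)
  have A: "finite A" "A \<subseteq> I" using assms by (auto simp: A_def)
  have sumA: "(\<Sum>i\<in>I. c i * \<xi> i) = (\<Sum>i\<in>A. c i * \<xi> i)" for \<xi>
    using assms by (intro sum.mono_neutral_right) (auto simp: A_def)
  have sqA: "(\<Sum>i\<in>I. (c i)\<^sup>2) = (\<Sum>i\<in>A. \<bar>c i\<bar>\<^sup>2)"
    using assms by simp (intro sum.mono_neutral_right, auto simp: A_def)
  show ?thesis
  proof (cases "A = {}")
    case True
    then show ?thesis by (simp add: sumA sqA)
  next
    case False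
    have "(\<Sum>i\<in>A. \<bar>c i\<bar>\<^sup>2) > 0"
      using A False by (intro sum_pos) (auto simp: A_def)
    then have \<sigma>: "\<sigma> > 0" by (simp add: \<sigma>_def sqA)
    have coord: "distributed ?P lborel (\<lambda>\<xi>. \<xi> i) std_normal_density" if "i \<in> I" for i
    proof -
      \<comment> \<open>The component law comes as a measure on \<open>std_normal\<close>, whereas
        densities refer to \<open>lborel\<close>. Both carry the Borel sets, so the image measure is
        the same.\<close>
      have "distr ?P lborel (\<lambda>\<xi>. \<xi> i) = distr ?P std_normal (\<lambda>\<xi>. \<xi> i)"
        by (intro distr_cong) auto
      also have "\<dots> = std_normal"
        using that prob_space_std_normal by (intro distr_PiM_component) auto
      finally have *: "distr ?P lborel (\<lambda>\<xi>. \<xi> i) = std_normal" .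
      have "(\<lambda>\<xi>. \<xi> i) \<in> measurable ?P std_normal"
        using that by (rule measurable_component_singleton)
      then have "(\<lambda>\<xi>. \<xi> i) \<in> measurable ?P lborel"
        by (simp cong: measurable_cong_sets)
      with * show ?thesis by (simp add: distributed_def)
    qed
    have "I \<noteq> {}" using A False by blast
    have "indep_vars (\<lambda>_. std_normal) (\<lambda>i \<xi>. \<xi> i) I"
      by (rule indep_vars_PiM_coordinates[OF prob_space_std_normal \<open>I \<noteq> {}\<close>])
    then have "indep_vars (\<lambda>_. std_normal) (\<lambda>i \<xi>. \<xi> i) A"
      by (rule indep_vars_subset[OF _ A(2)])
    then have indep: "indep_vars (\<lambda>_. borel) (\<lambda>i \<xi>. c i * \<xi> i) A"
      by (rule indep_vars_compose2) auto
    have "distributed ?P lborel (\<lambda>\<xi>. \<Sum>i\<in>A. c i * \<xi> i)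
        (normal_density (\<Sum>i\<in>A. 0) (sqrt (\<Sum>i\<in>A. \<bar>c i\<bar>\<^sup>2)))"
    proof (rule sum_indep_normal[OF A(1) False indep])
      fix i assume i: "i \<in> A"
      then have "c i \<noteq> 0" "i \<in> I" by (auto simp: A_def)
      then show "0 < \<bar>c i\<bar>" by simp
      show "distributed ?P lborel (\<lambda>\<xi>. c i * \<xi> i) (normal_density 0 \<bar>c i\<bar>)"
        using normal_density_affine[OF coord[OF \<open>i \<in> I\<close>] _ \<open>c i \<noteq> 0\<close>, of 0] by simp
    qed
    then have "distributed ?P lborel (\<lambda>\<xi>. \<Sum>i\<in>A. c i * \<xi> i) (normal_density 0 \<sigma>)"
      by (simp add: \<sigma>_def sqA)
    then have dist: "distributed ?P lborel (\<lambda>\<xi>. (\<Sum>i\<in>I. c i * \<xi> i) / \<sigma>) std_normal_density"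
      using normal_standard_normal_convert[OF \<sigma>, of "\<lambda>\<xi>. \<Sum>i\<in>I. c i * \<xi> i" 0] by (simp add: sumA)
    have "(\<integral>\<^sup>+\<xi>. ennreal \<bar>\<Sum>i\<in>I. c i * \<xi> i\<bar> \<partial>?P)
        = (\<integral>\<^sup>+\<xi>. ennreal \<sigma> * ennreal \<bar>(\<Sum>i\<in>I. c i * \<xi> i) / \<sigma>\<bar> \<partial>?P)"
      using \<sigma> by (intro nn_integral_cong) (simp add: ennreal_mult'[symmetric] abs_divide)
    also have "\<dots> = ennreal \<sigma> * (\<integral>\<^sup>+\<xi>. ennreal \<bar>(\<Sum>i\<in>I. c i * \<xi> i) / \<sigma>\<bar> \<partial>?P)"
      using distributed_measurable[OF dist] by (intro nn_integral_cmult) simp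
    also have "(\<integral>\<^sup>+\<xi>. ennreal \<bar>(\<Sum>i\<in>I. c i * \<xi> i) / \<sigma>\<bar> \<partial>?P)
        = (\<integral>\<^sup>+x. ennreal \<bar>x\<bar> \<partial>distr ?P lborel (\<lambda>\<xi>. (\<Sum>i\<in>I. c i * \<xi> i) / \<sigma>))"
      by (rule nn_integral_distr[OF distributed_measurable[OF dist], symmetric]) simp
    also have "\<dots> = (\<integral>\<^sup>+x. ennreal \<bar>x\<bar> \<partial>std_normal)"
      by (simp only: distributed_distr_eq_density[OF dist])
    finally show ?thesis
      using \<sigma> by (simp add: nn_integral_abs_std_normal ennreal_mult' \<sigma>_def)
  qed
qed


section \<open>Bias and noise of the estimator at fixed n\<close>

text \<open>The bandwidth balances the two errors: a bias of order \<open>h powr \<beta>\<close> and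
  a noise of order \<open>1 / sqrt (n * h)\<close> both become of order 1 after multiplication by
  the rate.\<close>

lemma rate_bandwidth:
  assumes "\<beta> > 0" "n > 0"
  shows "rate \<beta> n * bandwidth \<beta> n powr \<beta> = 1" "rate \<beta> n = sqrt (real n * bandwidth \<beta> n)"
proof -
  show "rate \<beta> n * bandwidth \<beta> n powr \<beta> = 1"
    using assms by (simp add: rate_def bandwidth_def powr_powr powr_add[symmetric])
  have "real n * bandwidth \<beta> n = real n powr (1 + - 1 / (2 * \<beta> + 1))"
    unfolding bandwidth_def powr_add using assms by simp
  also have "1 + - 1 / (2 * \<beta> + 1) = \<beta> / (2 * \<beta> + 1) + \<beta> / (2 * \<beta> + 1)"
    using assms by (simp add: add_divide_distrib[symmetric] eq_divide_eq left_diff_distrib)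
  finally have "real n * bandwidth \<beta> n = (rate \<beta> n)\<^sup>2"
    by (simp only: rate_def powr_add power2_eq_square)
  then show "rate \<beta> n = sqrt (real n * bandwidth \<beta> n)"
    by (simp add: rate_def)
qed

text \<open>Once the window lies in the half-open interval from 0 (excluded) to 1, the restriction
  to indices from 1 to \<open>n\<close> is automatic; strictness on the left rules out
  \<open>k = 0\<close>.\<close>

lemma kernel_sum_eq:
  assumes "n > 0" "0 < bandwidth \<beta> n" "0 < z - bandwidth \<beta> n" "z + bandwidth \<beta> n \<le> 1"
  shows "(\<Sum>k=1..n. kernel_weight z \<beta> n k * f k)
       = (\<Sum>k | \<bar>real k / real n - z\<bar> \<le> bandwidth \<beta> n. f k)"
proof -
  let ?W = "{k. \<bar>real k / real n - z\<bar> \<le> bandwidth \<beta> n}"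
  have "?W \<subseteq> {1..n}"
  proof
    fix k assume "k \<in> ?W"
    then have "\<bar>real k / real n - z\<bar> \<le> bandwidth \<beta> n" by simp
    then have "real k / real n > 0" "real k / real n \<le> 1" using assms by linarith+
    then show "k \<in> {1..n}" using assms(1) by (auto simp: zero_less_divide_iff divide_le_eq)
  qed
  then have "{1..n} \<inter> ?W = ?W" by blast
  moreover have "kernel_weight z \<beta> n k * f k = (if k \<in> ?W then f k else 0)" for k
    using assms(2) by (auto simp: kernel_weight_def design_def indicator_def abs_le_iff field_simps)
  ultimately show ?thesis
    by (simp only: sum.inter_restrict[symmetric] finite_atLeastAtMost)
qed

lemma kernel_mass_eq_card:
  assumes "n > 0" "0 < bandwidth \<beta> n" "0 < z - bandwidth \<beta> n" "z + bandwidth \<beta> n \<le> 1"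
  shows "kernel_mass z \<beta> n = real (card {k. \<bar>real k / real n - z\<bar> \<le> bandwidth \<beta> n})"
  using kernel_sum_eq[OF assms, of "\<lambda>_. 1"] by (simp add: kernel_mass_def)

text \<open>The first term bounds the integral of \<open>S - S z\<close> over the window through the
  defining condition of the class at \<open>t = h\<close>; the second is the Riemann-sum error for
  the Lipschitz constant \<open>inverse \<delta>\<close>.\<close>

lemma kernel_bias_bound:
  fixes z \<beta> \<delta> :: real and n :: nat
  defines "h \<equiv> bandwidth \<beta> n" and "q \<equiv> kernel_mass z \<beta> n"
  assumes S: "S \<in> U_class z \<beta> \<delta>" and "0 < \<delta>"
    and n: "n > 0" "1 \<le> real n * h" "0 < z - h" "z + h \<le> 1"
  shows "\<bar>1 / q * (\<Sum>k=1..n. kernel_weight z \<beta> n k * S (design n k)) - S z\<bar>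
         \<le> (real n * h * (\<delta> * h powr \<beta>) + 5 * inverse \<delta> * h) / q"
proof -
  have h: "h > 0" using n by (smt (verit) mult_nonneg_nonpos of_nat_0_le_iff)
  have q: "q = real (card {k. \<bar>real k / real n - z\<bar> \<le> h})"
    unfolding q_def h_def by (rule kernel_mass_eq_card) (use n h in \<open>auto simp: h_def\<close>)
  have "q > 0" using card_grid_window[OF n(1,2,3)] n(2) unfolding q by linarith
  define f where "f x = S x - S z" for x
  let ?W = "{k. \<bar>real k / real n - z\<bar> \<le> h}"
  have lip: "(inverse \<delta>)-lipschitz_on {z - h..z + h} f"
  proof (rule lipschitz_onI)
    fix x y assume "x \<in> {z - h..z + h}" "y \<in> {z - h..z + h}"
    then show "dist (f x) (f y) \<le> inverse \<delta> * dist x y"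
      using lipschitz_onD[OF U_class_lipschitz[OF S \<open>0 < \<delta>\<close>], of x y] n
      by (simp add: f_def dist_real_def)
  qed (use \<open>0 < \<delta>\<close> in simp)
  have "(f has_integral integral {z - h..z + h} f) (cbox (z - h) (z + h))"
    using lipschitz_on_continuous_on[OF lip]
    by (simp add: integrable_continuous_interval integrable_integral)
  \<comment> \<open>The substitution of \<open>z + h * u\<close> for the variable brings the window
    integral into the form used in \<open>U_class\<close>, at the price of a factor
    \<open>h\<close>.\<close>
  from has_integral_affinity'[OF this h, of z]
  have "((\<lambda>u. S (z + h * u) - S z) has_integral integral {z - h..z + h} f / h) {-1..1}"
    using h by (simp add: f_def add.commute divide_inverse mult.commute)
  then have "integral {-1..1} (\<lambda>u. S (z + h * u) - S z) = integral {z - h..z + h} f / h"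
    by (rule integral_unique)
  moreover have "\<bar>integral {-1..1} (\<lambda>u. S (z + h * u) - S z)\<bar> \<le> \<delta> * h powr \<beta>"
    using S h n unfolding U_class_def by auto
  ultimately have "\<bar>integral {z - h..z + h} f\<bar> \<le> h * (\<delta> * h powr \<beta>)"
    using h by (simp add: abs_divide pos_divide_le_eq mult.commute)
  then have "real n * \<bar>integral {z - h..z + h} f\<bar> \<le> real n * (h * (\<delta> * h powr \<beta>))"
    by (rule mult_left_mono) simp
  then have "\<bar>real n * integral {z - h..z + h} f\<bar> \<le> real n * h * (\<delta> * h powr \<beta>)"
    by (simp add: abs_mult mult.assoc)
  moreover have "\<bar>(\<Sum>k\<in>?W. f (real k / real n)) - real n * integral {z - h..z + h} f\<bar>
      \<le> 5 * inverse \<delta> * h"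
    by (rule sum_grid_window_error[OF lip _ n(1,2,3)]) (simp add: f_def)
  ultimately have "\<bar>\<Sum>k\<in>?W. f (real k / real n)\<bar> \<le> real n * h * (\<delta> * h powr \<beta>) + 5 * inverse \<delta> * h"
    by linarith
  then have "\<bar>\<Sum>k\<in>?W. f (real k / real n)\<bar> / q
      \<le> (real n * h * (\<delta> * h powr \<beta>) + 5 * inverse \<delta> * h) / q"
    using \<open>q > 0\<close> by (intro divide_right_mono) auto
  \<comment> \<open>The weights add up to \<open>q\<close>, so subtracting \<open>S z\<close> from
    the average amounts to subtracting it from each term.\<close>
  moreover have "1 / q * (\<Sum>k=1..n. kernel_weight z \<beta> n k * S (design n k)) - S z
      = (\<Sum>k\<in>?W. f (real k / real n)) / q"
    using kernel_sum_eq[of n \<beta> z "\<lambda>k. S (design n k)"] n h \<open>q > 0\<close> q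
    by (simp add: f_def sum_subtractf h_def design_def diff_divide_distrib)
  ultimately show ?thesis using \<open>q > 0\<close> by (simp add: abs_divide)
qed

text \<open>Kernel weights are 0 or 1 and hence equal their squares. The variance of the noise is
  therefore the mean of the squared scales over the window, divided by the mass; its root contains
  exactly the expression controlled by (A1).\<close>

lemma kernel_noise_expectation:
  assumes "0 < kernel_mass z \<beta> n"
  shows "(\<integral>\<^sup>+\<xi>. ennreal \<bar>\<Sum>k\<in>{1..n}. kernel_weight z \<beta> n k * G k / kernel_mass z \<beta> n * \<xi> k\<bar>
             \<partial>(\<Pi>\<^sub>M k\<in>{1..n}. std_normal))
    = ennreal (sqrt (1 / kernel_mass z \<beta> n * (\<Sum>k=1..n. kernel_weight z \<beta> n k * (G k)\<^sup>2))
        / sqrt (kernel_mass z \<beta> n) * (\<integral>x. \<bar>x\<bar> \<partial>std_normal))"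
proof -
  have "(kernel_weight z \<beta> n k)\<^sup>2 = kernel_weight z \<beta> n k" for k
    by (simp add: kernel_weight_def indicator_def)
  then have "(\<Sum>k\<in>{1..n}. (kernel_weight z \<beta> n k * G k / kernel_mass z \<beta> n)\<^sup>2)
    = 1 / kernel_mass z \<beta> n * (\<Sum>k=1..n. kernel_weight z \<beta> n k * (G k)\<^sup>2) / kernel_mass z \<beta> n"
    by (simp add: power_mult_distrib power_divide sum_divide_distrib[symmetric] power2_eq_square[of "kernel_mass z \<beta> n"])
  then show ?thesis
    by (subst nn_integral_abs_normal_sum) (simp_all add: real_sqrt_divide)
qed

lemma kernel_estimator_observation:
  "kernel_estimator z \<beta> n (observation g n S \<xi>) =
     1 / kernel_mass z \<beta> n * (\<Sum>k=1..n. kernel_weight z \<beta> n k * S (design n k)) +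
     (\<Sum>k\<in>{1..n}. kernel_weight z \<beta> n k * g (design n k) S / kernel_mass z \<beta> n * \<xi> k)"
  by (simp add: kernel_estimator_def observation_def distrib_left sum.distrib sum_distrib_left mult.assoc)

text \<open>The triangle inequality separates the deterministic bias from the noise. The bound is
  free of \<open>S\<close> and is arranged in terms of \<open>rate \<beta> n / real n\<close>,
  \<open>q / (real n * h)\<close> and \<open>\<epsilon>\<close>, whose limits can be taken
  separately.\<close>

lemma risk_at_bound:
  fixes z \<beta> \<delta> :: real and n :: nat and g :: "real \<Rightarrow> (real \<Rightarrow> real) \<Rightarrow> real"
  defines "h \<equiv> bandwidth \<beta> n" and "q \<equiv> kernel_mass z \<beta> n"
  assumes S: "S \<in> U_class z \<beta> \<delta>" and "0 < \<delta>" "0 < \<beta>"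
    and n: "n > 0" "1 \<le> real n * h" "0 < z - h" "z + h \<le> 1"
    and g_low: "0 < g_low" "g_low \<le> g z S"
    and A1: "\<bar>sqrt (1 / q * (\<Sum>k=1..n. kernel_weight z \<beta> n k * (g (design n k) S)\<^sup>2)) - g z S\<bar> \<le> \<epsilon>"
  shows "(\<integral>\<^sup>+ y. ennreal (rate \<beta> n * (\<bar>kernel_estimator z \<beta> n y - S z\<bar> / g z S)) \<partial>obs_law g n S)
    \<le> ennreal ((\<delta> + 5 / \<delta> * (rate \<beta> n / real n)) / (q / (real n * h)) / g_low
        + (1 + \<epsilon> / g_low) * (\<integral>x. \<bar>x\<bar> \<partial>std_normal) / sqrt (q / (real n * h)))"
proof -
  have h: "h > 0" using n by (smt (verit) mult_nonneg_nonpos of_nat_0_le_iff)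
  have q: "q = real (card {k. \<bar>real k / real n - z\<bar> \<le> h})"
    unfolding q_def h_def by (rule kernel_mass_eq_card) (use n h in \<open>auto simp: h_def\<close>)
  have "q > 0" using card_grid_window[OF n(1,2,3)] n(2) unfolding q by linarith
  have "g z S > 0" using g_low by simp
  have "\<epsilon> \<ge> 0" using A1 by linarith
  define b where "b = 1 / q * (\<Sum>k=1..n. kernel_weight z \<beta> n k * S (design n k)) - S z"
  define N where "N \<xi> = (\<Sum>k\<in>{1..n}. kernel_weight z \<beta> n k * g (design n k) S / q * \<xi> k)" for \<xi>
  define G where "G = sqrt (1 / q * (\<Sum>k=1..n. kernel_weight z \<beta> n k * (g (design n k) S)\<^sup>2))"
  define m where "m = (\<integral>x. \<bar>x\<bar> \<partial>std_normal)"
  define c where "c = rate \<beta> n / g z S"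
  let ?P = "\<Pi>\<^sub>M k\<in>{1..n}. std_normal"
  interpret prob_space ?P by (intro prob_space_PiM prob_space_std_normal)
  have "m \<ge> 0" unfolding m_def by simp
  have rate: "rate \<beta> n \<ge> 0" by (simp add: rate_def)
  have "c \<ge> 0" using rate \<open>g z S > 0\<close> by (simp add: c_def)
  have coord [measurable]: "(\<lambda>\<xi>. \<xi> k) \<in> borel_measurable ?P" if "k \<in> {1..n}" for k
    using measurable_component_singleton[OF that, of "\<lambda>_. std_normal"]
    by (simp cong: measurable_cong_sets)
  have obs: "observation g n S \<in> measurable ?P (\<Pi>\<^sub>M k\<in>{1..n}. borel)"
    unfolding observation_def by (intro measurable_restrict borel_measurable_add
        borel_measurable_times borel_measurable_const coord)
  have est: "kernel_estimator z \<beta> n \<in> borel_measurable (\<Pi>\<^sub>M k\<in>{1..n}. borel)"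
    unfolding kernel_estimator_def by measurable
  have [measurable]: "N \<in> borel_measurable ?P"
    unfolding N_def by (intro borel_measurable_sum borel_measurable_times borel_measurable_const coord)
  have "(\<integral>\<^sup>+ y. ennreal (rate \<beta> n * (\<bar>kernel_estimator z \<beta> n y - S z\<bar> / g z S)) \<partial>obs_law g n S)
      = (\<integral>\<^sup>+ \<xi>. ennreal (rate \<beta> n * (\<bar>kernel_estimator z \<beta> n (observation g n S \<xi>) - S z\<bar> / g z S)) \<partial>?P)"
    unfolding obs_law_def using est by (subst nn_integral_distr[OF obs]) simp_all
  also have "\<dots> = (\<integral>\<^sup>+ \<xi>. ennreal (c * \<bar>b + N \<xi>\<bar>) \<partial>?P)"
    unfolding kernel_estimator_observation by (simp add: b_def N_def c_def q_def add_diff_eq algebra_simps)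
  also have "\<dots> \<le> (\<integral>\<^sup>+ \<xi>. ennreal (c * \<bar>b\<bar>) + ennreal c * ennreal \<bar>N \<xi>\<bar> \<partial>?P)"
  proof (rule nn_integral_mono)
    fix \<xi>
    have "c * \<bar>b + N \<xi>\<bar> \<le> c * (\<bar>b\<bar> + \<bar>N \<xi>\<bar>)"
      using \<open>c \<ge> 0\<close> by (intro mult_left_mono abs_triangle_ineq)
    then show "ennreal (c * \<bar>b + N \<xi>\<bar>) \<le> ennreal (c * \<bar>b\<bar>) + ennreal c * ennreal \<bar>N \<xi>\<bar>"
      using \<open>c \<ge> 0\<close> by (simp add: ennreal_mult[symmetric] ennreal_plus[symmetric] distrib_left ennreal_leI
          del: ennreal_plus)
  qed
  also have "\<dots> = ennreal (c * \<bar>b\<bar>) + ennreal c * (\<integral>\<^sup>+ \<xi>. ennreal \<bar>N \<xi>\<bar> \<partial>?P)"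
    by (subst nn_integral_add) (simp_all add: nn_integral_cmult emeasure_space_1 del: One_nat_def)
  also have "(\<integral>\<^sup>+ \<xi>. ennreal \<bar>N \<xi>\<bar> \<partial>?P) = ennreal (G / sqrt q * m)"
    using kernel_noise_expectation[of z \<beta> n "\<lambda>k. g (design n k) S"] \<open>q > 0\<close>
    unfolding N_def G_def m_def q_def by simp
  also have "ennreal (c * \<bar>b\<bar>) + ennreal c * ennreal (G / sqrt q * m)
      = ennreal (c * \<bar>b\<bar> + c * (G / sqrt q * m))"
  proof -
    have "G \<ge> 0" unfolding G_def using \<open>q > 0\<close>
      by (intro real_sqrt_ge_zero mult_nonneg_nonneg sum_nonneg) (simp_all add: kernel_weight_def)
    then show ?thesis
      using \<open>c \<ge> 0\<close> \<open>m \<ge> 0\<close> \<open>q > 0\<close> by (simp add: ennreal_mult[symmetric] ennreal_plus[symmetric] del: ennreal_plus)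
  qed
  also have "\<dots> \<le> ennreal ((\<delta> + 5 / \<delta> * (rate \<beta> n / real n)) / (q / (real n * h)) / g_low
        + (1 + \<epsilon> / g_low) * m / sqrt (q / (real n * h)))"
  proof (rule ennreal_leI, rule add_mono)
    have "rate \<beta> n * \<bar>b\<bar> \<le> rate \<beta> n * ((real n * h * (\<delta> * h powr \<beta>) + 5 * inverse \<delta> * h) / q)"
      using kernel_bias_bound[OF S \<open>0 < \<delta>\<close> n(1)] n rate unfolding b_def h_def q_def
      by (intro mult_left_mono) auto
    also have "\<dots> = (real n * h * \<delta> * (rate \<beta> n * h powr \<beta>) + 5 * inverse \<delta> * h * rate \<beta> n) / q"
      by (simp add: algebra_simps)
    also have "rate \<beta> n * h powr \<beta> = 1"
      unfolding h_def by (rule rate_bandwidth) fact+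
    also have "(real n * h * \<delta> * 1 + 5 * inverse \<delta> * h * rate \<beta> n) / q
        = (\<delta> + 5 / \<delta> * (rate \<beta> n / real n)) / (q / (real n * h))"
      using \<open>q > 0\<close> h n(1) \<open>0 < \<delta>\<close> by (simp add: field_simps)
    finally have bias: "rate \<beta> n * \<bar>b\<bar> \<le> (\<delta> + 5 / \<delta> * (rate \<beta> n / real n)) / (q / (real n * h))" .
    have "0 \<le> rate \<beta> n * \<bar>b\<bar>" using rate by simp
    then have "rate \<beta> n * \<bar>b\<bar> / g z S \<le> (\<delta> + 5 / \<delta> * (rate \<beta> n / real n)) / (q / (real n * h)) / g_low"
      by (intro frac_le bias g_low order_trans[OF _ bias])
    then show "c * \<bar>b\<bar> \<le> (\<delta> + 5 / \<delta> * (rate \<beta> n / real n)) / (q / (real n * h)) / g_low"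
      by (simp add: c_def)
  next
    \<comment> \<open>By (A1) the noise scale exceeds \<open>g z S\<close> by at most
      \<open>\<epsilon>\<close>; dividing by \<open>g z S\<close> leaves 1 plus an error controlled
      through the lower bound \<open>g_low\<close>.\<close>
    have "G \<le> g z S + \<epsilon>" using A1 unfolding G_def by linarith
    then have "G / g z S \<le> 1 + \<epsilon> / g z S"
      using \<open>g z S > 0\<close> by (simp add: field_simps)
    also have "\<dots> \<le> 1 + \<epsilon> / g_low"
      using g_low \<open>\<epsilon> \<ge> 0\<close> by (intro add_left_mono divide_left_mono) auto
    finally have "G / g z S * (m / sqrt (q / (real n * h))) \<le> (1 + \<epsilon> / g_low) * (m / sqrt (q / (real n * h)))"
      using \<open>m \<ge> 0\<close> \<open>q > 0\<close> h by (intro mult_right_mono) auto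
    \<comment> \<open>Since the rate is \<open>sqrt (n * h)\<close>, the quotient of the rate by
      \<open>sqrt q\<close> depends only on \<open>q / (n * h)\<close>.\<close>
    moreover have "c * (G / sqrt q * m) = G / g z S * (m / sqrt (q / (real n * h)))"
      using rate_bandwidth(2)[OF \<open>0 < \<beta>\<close> n(1)] by (simp add: c_def h_def real_sqrt_divide)
    ultimately show "c * (G / sqrt q * m) \<le> (1 + \<epsilon> / g_low) * m / sqrt (q / (real n * h))"
      by simp
  qed
  finally show ?thesis unfolding m_def .
qed

section \<open>Limits in n and then in the class parameter\<close>

lemma bandwidth_tendsto_0:
  assumes "\<beta> > 0"
  shows "bandwidth \<beta> \<longlonglongrightarrow> 0"
  unfolding bandwidth_def using assms
  by (intro tendsto_neg_powr filterlim_real_sequentially) (simp add: field_simps)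

lemma rate_div_tendsto_0:
  assumes "\<beta> > 0"
  shows "(\<lambda>n. rate \<beta> n / real n) \<longlonglongrightarrow> 0"
proof (rule Lim_transform_eventually)
  show "(\<lambda>n. real n powr (\<beta> / (2 * \<beta> + 1) - 1)) \<longlonglongrightarrow> 0"
    using assms by (intro tendsto_neg_powr filterlim_real_sequentially) (simp add: field_simps)
  show "\<forall>\<^sub>F n in sequentially. real n powr (\<beta> / (2 * \<beta> + 1) - 1) = rate \<beta> n / real n"
    using eventually_gt_at_top[of 0] by eventually_elim (simp add: rate_def powr_diff)
qed

lemma filterlim_n_bandwidth:
  assumes "\<beta> > 0"
  shows "filterlim (\<lambda>n. real n * bandwidth \<beta> n) at_top sequentially"
proof -
  have "filterlim (\<lambda>n. real n powr (1 - 1 / (2 * \<beta> + 1))) at_top sequentially"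
    using assms by (intro filterlim_compose[OF real_powr_at_top filterlim_real_sequentially])
      (simp add: field_simps)
  then show ?thesis
  proof (rule filterlim_cong[THEN iffD1, rotated -1])
    show "\<forall>\<^sub>F n in sequentially. real n powr (1 - 1 / (2 * \<beta> + 1)) = real n * bandwidth \<beta> n"
      using eventually_gt_at_top[of 0]
      by eventually_elim (simp add: bandwidth_def powr_diff powr_minus divide_inverse)
  qed simp_all
qed

text \<open>Collects the side conditions under which the bounds at fixed \<open>n\<close>
  apply.\<close>

lemma eventually_bandwidth_window:
  assumes "0 < \<beta>" "0 < z" "z < 1"
  shows "\<forall>\<^sub>F n in sequentially. n > 0 \<and> 1 \<le> real n * bandwidth \<beta> n \<and> 0 < bandwidth \<beta> n \<and>
           0 < z - bandwidth \<beta> n \<and> z + bandwidth \<beta> n \<le> 1"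
proof -
  have "\<forall>\<^sub>F n in sequentially. bandwidth \<beta> n < min z (1 - z)"
    using assms by (intro order_tendstoD[OF bandwidth_tendsto_0]) auto
  moreover have "\<forall>\<^sub>F n in sequentially. 1 \<le> real n * bandwidth \<beta> n"
    using filterlim_n_bandwidth[OF assms(1)] by (simp add: filterlim_at_top)
  ultimately show ?thesis
    using eventually_gt_at_top[of 0] by eventually_elim (auto simp: bandwidth_def)
qed

text \<open>The mass counts the grid points in the window, hence differs from
  \<open>2 * n * h\<close> by at most 1, while \<open>n * h\<close> tends to infinity.\<close>

lemma kernel_mass_ratio_tendsto:
  assumes "0 < \<beta>" "0 < z" "z < 1"
  shows "(\<lambda>n. kernel_mass z \<beta> n / (real n * bandwidth \<beta> n)) \<longlonglongrightarrow> 2"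
proof -
  have "(\<lambda>n. 1 / (real n * bandwidth \<beta> n)) \<longlonglongrightarrow> 0"
    by (intro tendsto_divide_0[OF tendsto_const] filterlim_at_top_imp_at_infinity
        filterlim_n_bandwidth assms)
  moreover have "\<forall>\<^sub>F n in sequentially.
      norm (kernel_mass z \<beta> n / (real n * bandwidth \<beta> n) - 2) \<le> 1 / (real n * bandwidth \<beta> n)"
    using eventually_bandwidth_window[OF assms]
  proof eventually_elim
    case (elim n)
    let ?d = "real n * bandwidth \<beta> n"
    have "\<bar>kernel_mass z \<beta> n - 2 * ?d\<bar> \<le> 1"
      using card_grid_window[of n "bandwidth \<beta> n" z] elim by (simp add: kernel_mass_eq_card)
    moreover have "kernel_mass z \<beta> n / ?d - 2 = (kernel_mass z \<beta> n - 2 * ?d) / ?d"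
      using elim by (simp add: diff_divide_distrib)
    ultimately show ?case
      using elim by (simp add: abs_divide divide_right_mono)
  qed
  ultimately have "(\<lambda>n. kernel_mass z \<beta> n / (real n * bandwidth \<beta> n) - 2) \<longlonglongrightarrow> 0"
    by (rule Lim_null_comparison[rotated])
  then show ?thesis by (simp add: LIM_zero_iff)
qed

lemma limsup_risk_bound:
  fixes z \<beta> \<delta> :: real
  assumes "0 < \<beta>" "0 < z" "z < 1" "\<delta> \<in> {0<..<1}" and A1: "cond_A1 z \<beta> g"
    and g_low: "0 < g_low" "\<And>S. S \<in> C1 \<Longrightarrow> g_low \<le> g z S"
  shows "limsup (\<lambda>n. risk z \<beta> g \<delta> n (kernel_estimator z \<beta> n))
       \<le> ennreal (\<delta> / 2 / g_low + (\<integral>x. \<bar>x\<bar> \<partial>std_normal) / sqrt 2)"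
proof -
  define E where "E n = (SUP S\<in>U_class z \<beta> \<delta>. ennreal
        \<bar>sqrt (1 / kernel_mass z \<beta> n *
              (\<Sum>k=1..n. kernel_weight z \<beta> n k * (g (design n k) S)\<^sup>2)) - g z S\<bar>)" for n
  define \<rho> where "\<rho> n = kernel_mass z \<beta> n / (real n * bandwidth \<beta> n)" for n
  define r where "r n = (\<delta> + 5 / \<delta> * (rate \<beta> n / real n)) / \<rho> n / g_low
        + (1 + enn2real (E n) / g_low) * (\<integral>x. \<bar>x\<bar> \<partial>std_normal) / sqrt (\<rho> n)" for n
  have E: "E \<longlonglongrightarrow> 0"
    using A1 assms(4) unfolding cond_A1_def E_def by blast
  then have "\<forall>\<^sub>F n in sequentially. E n < 1"
    by (rule order_tendstoD) simp
  then have "\<forall>\<^sub>F n in sequentially. risk z \<beta> g \<delta> n (kernel_estimator z \<beta> n) \<le> ennreal (r n)"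
    using eventually_bandwidth_window[OF assms(1-3)]
  proof eventually_elim
    case (elim n)
    \<comment> \<open>\<open>enn2real\<close> sends infinity to 0, so the supremum in (A1) must be
      finite before its real value can serve as a bound for each \<open>S\<close>.\<close>
    have fin: "E n < \<top>" using elim(1) by (rule less_trans) simp
    show ?case
      unfolding risk_def r_def \<rho>_def
    proof (intro SUP_least risk_at_bound)
      fix S assume S: "S \<in> U_class z \<beta> \<delta>"
      show "g_low \<le> g z S"
        using S by (intro g_low) (auto simp: U_class_def holder_class_def holder_ball_def)
      have "ennreal \<bar>sqrt (1 / kernel_mass z \<beta> n *
              (\<Sum>k=1..n. kernel_weight z \<beta> n k * (g (design n k) S)\<^sup>2)) - g z S\<bar> \<le> E n"
        unfolding E_def using S by (rule SUP_upper)
      from enn2real_mono[OF this fin]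
      show "\<bar>sqrt (1 / kernel_mass z \<beta> n *
              (\<Sum>k=1..n. kernel_weight z \<beta> n k * (g (design n k) S)\<^sup>2)) - g z S\<bar> \<le> enn2real (E n)"
        by simp
    qed (use elim assms in auto)
  qed
  then have "limsup (\<lambda>n. risk z \<beta> g \<delta> n (kernel_estimator z \<beta> n)) \<le> limsup (\<lambda>n. ennreal (r n))"
    by (rule Limsup_mono)
  also have "\<dots> = ennreal (\<delta> / 2 / g_low + (\<integral>x. \<bar>x\<bar> \<partial>std_normal) / sqrt 2)"
  proof (intro lim_imp_Limsup tendsto_ennrealI)
    \<comment> \<open>Here \<open>rate \<beta> n / real n\<close> and the error from (A1) vanish and
      the mass ratio tends to 2, which produces both the 2 under the bias and the
      \<open>sqrt 2\<close> under the noise.\<close>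
    have "r \<longlonglongrightarrow> (\<delta> + 5 / \<delta> * 0) / 2 / g_low
        + (1 + 0 / g_low) * (\<integral>x. \<bar>x\<bar> \<partial>std_normal) / sqrt 2"
      unfolding r_def \<rho>_def using E g_low
      by (intro tendsto_intros rate_div_tendsto_0 kernel_mass_ratio_tendsto assms) auto
    then show "r \<longlonglongrightarrow> \<delta> / 2 / g_low + (\<integral>x. \<bar>x\<bar> \<partial>std_normal) / sqrt 2" by simp
  qed simp
  finally show ?thesis .
qed

theorem theorem3p2:
  fixes z\<^sub>0 \<alpha> \<beta> :: real and g :: "real \<Rightarrow> (real \<Rightarrow> real) \<Rightarrow> real"
  assumes "z\<^sub>0 \<in> {0<..<1}" and "\<alpha> \<in> {0<..1}" and "\<beta> = 1 + \<alpha>"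
    and "\<forall>x\<in>{0..1}. \<forall>S\<in>C1. g x S > 0"
    and "cond_A1 z\<^sub>0 \<beta> g" and "cond_A2 g" and "cond_A3 g"
  shows "Limsup (at_right 0) (\<lambda>\<delta>. limsup (\<lambda>n. risk z\<^sub>0 \<beta> g \<delta> n (kernel_estimator z\<^sub>0 \<beta> n)))
           \<le> ennreal ((\<integral>\<xi>. \<bar>\<xi>\<bar> \<partial>std_normal) / sqrt 2)"
proof -
  obtain g_low where g_low: "0 < g_low" "\<And>S. S \<in> C1 \<Longrightarrow> g_low \<le> g z\<^sub>0 S"
    using assms(1,6) unfolding cond_A2_def by (metis greaterThanLessThan_iff atLeastAtMost_iff less_imp_le)
  let ?m = "\<integral>\<xi>. \<bar>\<xi>\<bar> \<partial>std_normal"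
  \<comment> \<open>The limit in \<open>n\<close> leaves a bias term linear in
    \<open>\<delta>\<close>. The constant \<open>g_low\<close> was fixed before
    \<open>\<delta>\<close>, so this term vanishes as \<open>\<delta>\<close> decreases to
    0.\<close>
  have "\<forall>\<^sub>F \<delta> in at_right 0. \<delta> \<in> {0<..<1::real}"
    by (rule eventually_at_right_real) simp
  then have "\<forall>\<^sub>F \<delta> in at_right 0. limsup (\<lambda>n. risk z\<^sub>0 \<beta> g \<delta> n (kernel_estimator z\<^sub>0 \<beta> n))
      \<le> ennreal (\<delta> / 2 / g_low + ?m / sqrt 2)"
    by eventually_elim (rule limsup_risk_bound, use assms g_low in auto)
  then have "Limsup (at_right 0) (\<lambda>\<delta>. limsup (\<lambda>n. risk z\<^sub>0 \<beta> g \<delta> n (kernel_estimator z\<^sub>0 \<beta> n)))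
      \<le> Limsup (at_right 0) (\<lambda>\<delta>. ennreal (\<delta> / 2 / g_low + ?m / sqrt 2))"
    by (rule Limsup_mono)
  also have "\<dots> = ennreal (?m / sqrt 2)"
  proof (intro lim_imp_Limsup tendsto_ennrealI)
    have "((\<lambda>\<delta>. \<delta> / 2 / g_low + ?m / sqrt 2) \<longlongrightarrow> 0 / 2 / g_low + ?m / sqrt 2) (at_right 0)"
      using g_low by (intro tendsto_intros) auto
    then show "((\<lambda>\<delta>. \<delta> / 2 / g_low + ?m / sqrt 2) \<longlongrightarrow> ?m / sqrt 2) (at_right 0)" by simp
  qed simp
  finally show ?thesis .
qed

end
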